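(* Let $(x_k)\subset X$ be generated by $x_{k+1}=x_k+\Delta s_k(\omega_k)$, and assume that for every $k$ the inexact step $\Delta s_k(\omega_k)$ satisfies the subgradient inexactness criterion $$\lambda_{x_k,\omega_k}(\Delta s_k(\omega_k))\le\lambda^{\mu_k}_{x_k,\tilde\omega_k}\big(\Delta x_k^{\mu_k}(\tilde\omega_k)\big)\quad\text{for some } 0<\tilde\omega_k<\tilde\omega_{\max}$$ and the sufficient decrease criterion $$F(x_k+\Delta s_k(\omega_k))-F(x_k)\le\gamma\,\lambda_{x_k,\omega_k}(\Delta s_k(\omega_k)),$$ where $\mu_k\in\partial_Fg(x_k)$, $\tilde\omega_{\max}>0$ and $\gamma\in\,]0,1[$ are given. Then every accumulation point $\bar x$ (in norm) of $(x_k)$ is a stationary point of $\min_{x\in X}F(x)$, i.e. $0\in\partial_FF(\bar x)$. In particular, the comparative sequence $y_k:=x_k+\Delta x_k(\omega_k^c)$, $\omega_k^c:=\tilde\omega_{\max}+\omega_k+1$, satisfies $$\operatorname{dist}(\partial_FF(y_k),0)\to0\quad\text{and}\quad\|x_k-y_k\|_X\to0 ,$$ so that also $y_k\to\bar x$ along the subsequence on which $x_k\to\bar x$.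
   Context: $(X,\langle\cdot,\cdot\rangle_X)$ is a real Hilbert space with norm $\|\cdot\|_X$ and dual $X^*$. $F=f+g$ with $f,g:X\to\mathbb R$. The function $f$ is continuously differentiable and $f':X\to X^*$ is Lipschitz with constant $L_f>0$. The function $g$ is lower semi-continuous and there is $\kappa_2\in\mathbb R$ with $$g(sx+(1-s)y)\le s g(x)+(1-s)g(y)-\tfrac{\kappa_2}{2}s(1-s)\|x-y\|_X^2\quad\forall x,y\in X,\ s\in[0,1].$$ For each $x\in X$, $H_x\in\mathcal L(X,X^* )$ is a bounded linear operator identified with a symmetric bilinear form. Along the iterates, $\|H_{x_k}\|_{\mathcal L(X,X^* )}\le M$ for some uniform $M>0$, and for each $k$ there is $\kappa_1\in\mathbb R$ (possibly depending on $k$) with $H_{x_k}(v,v)\ge\kappa_1\|v\|_X^2$ for all $v\in X$; the regularization parameters always satisfy $\omega_k>-(\kappa_1+\kappa_2)$. For $x\in X$, $$\lambda_{x,\omega}(\delta x)=f'(x)\delta x+\tfrac12H_x(\delta x,\delta x)+\tfrac\omega2\|\delta x\|_X^2+g(x+\delta x)-g(x),\qquad \Delta x(\omega)=\operatorname*{argmin}_{\delta x\in X}\lambda_{x,\omega}(\delta x),$$ and $\Delta x_k(\omega)$ is this exact step at $x=x_k$. For $\mu\in\partial_Fg(x)$ and $\hat\omega>0$, $$\lambda^\mu_{x,\hat\omega}(\delta x)=f'(x)\delta x+\mu\,\delta x+\tfrac{\hat\omega}2\|\delta x\|_X^2,\qquad \Delta x^\mu(\hat\omega)=\operatorname*{argmin}_{\delta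 x\in X}\lambda^\mu_{x,\hat\omega}(\delta x),$$ and $\Delta x_k^{\mu_k}$ is this step at $x=x_k$ with $\mu=\mu_k$. $\partial_F$ denotes the Fréchet subdifferential: $\ell\in\partial_Fh(x)$ iff $\ell\in X^*$ and $\liminf_{v\to0}\frac{h(x+v)-h(x)-\ell(v)}{\|v\|_X}\ge0$. Distances of subsets of $X^*$ to $0$ are measured in $\|\cdot\|_{X^*}$. It is assumed that the sequence of objective values $(F(x_k))$ is bounded from below and that the regularization parameters $(\omega_k)$ are bounded. *)

theory Defs
  imports "HOL-Analysis.Analysis"
begin

text \<open>The dual space of \<open>'a\<close> is the type \<open>'a \<Rightarrow>\<^sub>L real\<close> with its operator norm. An operator
  from \<open>'a\<close> into its dual has type \<open>'a \<Rightarrow>\<^sub>L ('a \<Rightarrow>\<^sub>L real)\<close> and is read as the bilinear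
  form \<open>(u, v) \<mapsto> B u v\<close>.\<close>

definition lower_semicont :: "('a::topological_space \<Rightarrow> real) \<Rightarrow> bool" where
  "lower_semicont h \<longleftrightarrow> (\<forall>x. ereal (h x) \<le> Liminf (at x) (\<lambda>z. ereal (h z)))"

definition frechet_subdiff ::
  "('a::real_normed_vector \<Rightarrow> real) \<Rightarrow> 'a \<Rightarrow> ('a \<Rightarrow>\<^sub>L real) set" where
  "frechet_subdiff h x =
     {l. 0 \<le> Liminf (at 0) (\<lambda>v. ereal ((h (x + v) - h x - blinfun_apply l v) / norm v))}"

text \<open>The value is \<open>\<infinity>\<close> on the empty set, whereas \<open>infdist\<close> would return \<open>0\<close> there.\<close>

definition dist_to_zero :: "('b::real_normed_vector) set \<Rightarrow> ereal" where
  "dist_to_zero S = (INF l\<in>S. ereal (norm l))"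

definition model ::
  "('a::real_normed_vector \<Rightarrow> ('a \<Rightarrow>\<^sub>L real)) \<Rightarrow> ('a \<Rightarrow> real) \<Rightarrow> ('a \<Rightarrow> ('a \<Rightarrow>\<^sub>L ('a \<Rightarrow>\<^sub>L real)))
    \<Rightarrow> 'a \<Rightarrow> real \<Rightarrow> 'a \<Rightarrow> real" where
  "model f' g H x \<omega> d =
     blinfun_apply (f' x) d + 1/2 * blinfun_apply (blinfun_apply (H x) d) d
       + \<omega> / 2 * (norm d)\<^sup>2 + g (x + d) - g x"

text \<open>\<open>arg_min\<close> selects some minimizer and is unspecified if none exists. The minimizer exists
  and is unique whenever \<open>H x\<close> is bounded below by \<open>\<kappa>\<^sub>1\<close>, \<open>g\<close> is lower semicontinuous and
  \<open>\<kappa>\<^sub>2\<close>-convex, and \<open>\<omega> > - (\<kappa>\<^sub>1 + \<kappa>\<^sub>2)\<close>; that of \<open>subgrad_model\<close> below whenever \<open>\<omega> > 0\<close>.\<close>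

definition exact_step ::
  "('a::real_normed_vector \<Rightarrow> ('a \<Rightarrow>\<^sub>L real)) \<Rightarrow> ('a \<Rightarrow> real) \<Rightarrow> ('a \<Rightarrow> ('a \<Rightarrow>\<^sub>L ('a \<Rightarrow>\<^sub>L real)))
    \<Rightarrow> 'a \<Rightarrow> real \<Rightarrow> 'a" where
  "exact_step f' g H x \<omega> = arg_min (model f' g H x \<omega>) (\<lambda>_. True)"

definition subgrad_model ::
  "('a::real_normed_vector \<Rightarrow> ('a \<Rightarrow>\<^sub>L real)) \<Rightarrow> ('a \<Rightarrow>\<^sub>L real) \<Rightarrow> 'a \<Rightarrow> real \<Rightarrow> 'a \<Rightarrow> real" where
  "subgrad_model f' \<mu> x \<omega> d =
     blinfun_apply (f' x) d + blinfun_apply \<mu> d + \<omega> / 2 * (norm d)\<^sup>2"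

definition subgrad_step ::
  "('a::real_normed_vector \<Rightarrow> ('a \<Rightarrow>\<^sub>L real)) \<Rightarrow> ('a \<Rightarrow>\<^sub>L real) \<Rightarrow> 'a \<Rightarrow> real \<Rightarrow> 'a" where
  "subgrad_step f' \<mu> x \<omega> = arg_min (subgrad_model f' \<mu> x \<omega>) (\<lambda>_. True)"

definition subgradient_inexactness ::
  "('a::real_normed_vector \<Rightarrow> ('a \<Rightarrow>\<^sub>L real)) \<Rightarrow> ('a \<Rightarrow> real) \<Rightarrow> ('a \<Rightarrow> ('a \<Rightarrow>\<^sub>L ('a \<Rightarrow>\<^sub>L real)))
    \<Rightarrow> real \<Rightarrow> 'a \<Rightarrow> ('a \<Rightarrow>\<^sub>L real) \<Rightarrow> real \<Rightarrow> 'a \<Rightarrow> bool" where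
  "subgradient_inexactness f' g H \<omega>max x \<mu> \<omega> d \<longleftrightarrow>
     (\<exists>\<omega>t. 0 < \<omega>t \<and> \<omega>t < \<omega>max \<and>
        model f' g H x \<omega> d \<le> subgrad_model f' \<mu> x \<omega>t (subgrad_step f' \<mu> x \<omega>t))"

definition sufficient_decrease ::
  "('a::real_normed_vector \<Rightarrow> real) \<Rightarrow> ('a \<Rightarrow> ('a \<Rightarrow>\<^sub>L real)) \<Rightarrow> ('a \<Rightarrow> real)
    \<Rightarrow> ('a \<Rightarrow> ('a \<Rightarrow>\<^sub>L ('a \<Rightarrow>\<^sub>L real))) \<Rightarrow> real \<Rightarrow> 'a \<Rightarrow> real \<Rightarrow> 'a \<Rightarrow> bool" where
  "sufficient_decrease F f' g H \<gamma> x \<omega> d \<longleftrightarrow> F (x + d) - F x \<le> \<gamma> * model f' g H x \<omega> d"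

definition accumulation_point :: "(nat \<Rightarrow> 'a::topological_space) \<Rightarrow> 'a \<Rightarrow> bool" where
  "accumulation_point x p \<longleftrightarrow> (\<exists>r. strict_mono r \<and> (x \<circ> r) \<longlonglongrightarrow> p)"

end

theory Submission
  imports Defs
begin

text \<open>Put \<open>l\<^sub>k = f' x\<^sub>k + \<mu>\<^sub>k\<close>. The minimum of the subgradient model is at most
  \<open>- \<parallel>l\<^sub>k\<parallel>\<^sup>2 / (2 \<omega>max)\<close>, so the two criteria give
  \<open>F x\<^sub>k - F x\<^sub>k\<^sub>+\<^sub>1 \<ge> \<gamma> / (2 \<omega>max) \<parallel>l\<^sub>k\<parallel>\<^sup>2\<close>, and hence \<open>l\<^sub>k \<rightarrow> 0\<close> because \<open>F x\<^sub>k\<close> is bounded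
  below. Since \<open>l\<^sub>k\<close> is a subgradient of \<open>F\<close> at \<open>x\<^sub>k\<close> and the subdifferential of a lower
  semicontinuous, semiconvex function has closed graph, accumulation points are stationary.
  The model with parameter \<open>\<omega>max + \<omega>\<^sub>k + 1\<close> is strongly convex with modulus at least \<open>1\<close> and has
  the subgradient \<open>l\<^sub>k\<close> at \<open>0\<close>, so its minimizer has norm at most \<open>2 \<parallel>l\<^sub>k\<parallel>\<close>. Its optimality condition
  provides a subgradient of \<open>F\<close> at \<open>y\<^sub>k\<close> whose norm is bounded by a multiple of the step length.\<close>

section \<open>Sequential lower semicontinuity and calculus of Frechet subgradients\<close>

lemma lower_semicont_seq_le:
  fixes h :: "'a::t2_space \<Rightarrow> real"
  assumes h: "lower_semicont h" and X: "X \<longlonglongrightarrow> p"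
    and b: "b \<longlonglongrightarrow> L" and le: "\<And>n. h (X n) \<le> b n"
  shows "h p \<le> L"
proof (rule field_le_epsilon)
  fix e :: real assume "e > 0"
  then have "ereal (h p - e) < ereal (h p)" by simp
  moreover have "ereal (h p) \<le> Liminf (at p) (\<lambda>z. ereal (h z))"
    using h unfolding lower_semicont_def by blast
  ultimately have "eventually (\<lambda>z. ereal (h p - e) < ereal (h z)) (at p)"
    unfolding le_Liminf_iff by blast
  \<comment> \<open>The filter \<open>at p\<close> leaves out \<open>p\<close> itself, where the
    inequality holds because \<open>e > 0\<close>; this matters since \<open>X\<close> may take the
    value \<open>p\<close>.\<close>
  then have "eventually (\<lambda>z. h p - e < h z) (nhds p)"
    using \<open>e > 0\<close> by (auto simp: eventually_nhds_conv_at)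
  then have "eventually (\<lambda>n. h p - e < h (X n)) sequentially"
    using X by (rule eventually_compose_filterlim)
  then have "eventually (\<lambda>n. h p - e \<le> b n) sequentially"
    by (rule eventually_mono) (use le in \<open>smt (verit)\<close>)
  then have "h p - e \<le> L"
    using b by (intro tendsto_lowerbound) auto
  then show "h p \<le> L + e" by simp
qed

text \<open>A form free of quotients and extended reals. The point \<open>v = 0\<close>, excluded
  from the liminf, may be included since both sides vanish there.\<close>

lemma frechet_subdiff_iff:
  "l \<in> frechet_subdiff h x \<longleftrightarrow>
     (\<forall>e>0. \<exists>d>0. \<forall>v. norm v < d \<longrightarrow> - e * norm v \<le> h (x + v) - h x - blinfun_apply l v)"
  (is "?L \<longleftrightarrow> ?R")
proof
  assume ?L
  show ?R
  proof (intro allI impI)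
    fix e :: real assume "e > 0"
    then have "ereal (- e) < 0" by simp
    with \<open>?L\<close> have "eventually (\<lambda>v. ereal (- e) <
        ereal ((h (x + v) - h x - blinfun_apply l v) / norm v)) (at 0)"
      unfolding frechet_subdiff_def mem_Collect_eq le_Liminf_iff by blast
    then obtain d where d: "d > 0"
      "\<And>v. v \<noteq> 0 \<Longrightarrow> norm v < d \<Longrightarrow> - e < (h (x + v) - h x - blinfun_apply l v) / norm v"
      by (auto simp: eventually_at)
    have "- e * norm v \<le> h (x + v) - h x - blinfun_apply l v" if "norm v < d" for v
      using d(2)[of v] that by (cases "v = 0") (auto simp: pos_less_divide_eq)
    with d(1) show "\<exists>d>0. \<forall>v. norm v < d \<longrightarrow>
        - e * norm v \<le> h (x + v) - h x - blinfun_apply l v"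
      by blast
  qed
next
  assume R: ?R
  have "eventually (\<lambda>v. c < ereal ((h (x + v) - h x - blinfun_apply l v) / norm v)) (at 0)"
    if "c < 0" for c :: ereal
  proof -
    \<comment> \<open>\<open>c\<close> may be minus infinity, so the tolerance \<open>- e\<close>
      comes from a real number strictly between \<open>c\<close> and \<open>0\<close>.\<close>
    obtain e where e: "c < ereal e" "e < 0"
      using \<open>c < 0\<close> ereal_dense2 by (metis ereal_less(1) zero_ereal_def ereal_less_eq(3) less_ereal.simps(1))
    then obtain d where d: "d > 0"
      "\<And>v. norm v < d \<Longrightarrow> - (- e) * norm v \<le> h (x + v) - h x - blinfun_apply l v"
      using R[rule_format, of "- e"] by auto
    have "c < ereal ((h (x + v) - h x - blinfun_apply l v) / norm v)" if "v \<noteq> 0" "norm v < d" for v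
    proof -
      have "e \<le> (h (x + v) - h x - blinfun_apply l v) / norm v"
        using d(2)[OF that(2)] that(1) by (simp add: pos_le_divide_eq)
      then show ?thesis using e(1) by (meson ereal_less_eq(3) less_le_trans)
    qed
    then show ?thesis
      using \<open>d > 0\<close> by (auto simp: eventually_at intro!: exI[of _ d])
  qed
  then show ?L
    unfolding frechet_subdiff_def mem_Collect_eq le_Liminf_iff by blast
qed

text \<open>A quadratic error is small compared with \<open>norm v\<close>: within radius
  \<open>e / (\<bar>C\<bar> + 1)\<close> it stays below \<open>e * norm v\<close>. The
  \<open>+ 1\<close> covers \<open>C = 0\<close>.\<close>

lemma frechet_subdiffI_quadratic:
  assumes "\<And>v. h (x + v) - h x - blinfun_apply l v \<ge> - C * (norm v)\<^sup>2"
  shows "l \<in> frechet_subdiff h x"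
  unfolding frechet_subdiff_iff
proof (intro allI impI)
  fix e :: real assume "e > 0"
  define d where "d = e / (\<bar>C\<bar> + 1)"
  have "- e * norm v \<le> h (x + v) - h x - blinfun_apply l v" if "norm v < d" for v
  proof -
    have "(\<bar>C\<bar> + 1) * norm v \<le> e"
      using that by (simp add: d_def pos_less_divide_eq mult.commute less_imp_le)
    then have "(\<bar>C\<bar> + 1) * norm v * norm v \<le> e * norm v"
      by (rule mult_right_mono) simp
    moreover have "C * (norm v)\<^sup>2 \<le> (\<bar>C\<bar> + 1) * (norm v)\<^sup>2"
      by (rule mult_right_mono) auto
    ultimately show ?thesis
      using assms[of v] by (simp add: power2_eq_square mult.assoc)
  qed
  moreover have "d > 0" using \<open>e > 0\<close> by (simp add: d_def)
  ultimately show "\<exists>d>0. \<forall>v. norm v < d \<longrightarrow>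
      - e * norm v \<le> h (x + v) - h x - blinfun_apply l v"
    by blast
qed

text \<open>The remainder of \<open>f\<close> is of smaller order than \<open>norm v\<close>, so it
  takes one half of the tolerance and the inequality for \<open>g\<close> the other half.\<close>

lemma frechet_subdiff_add_differentiable:
  assumes f: "(f has_derivative blinfun_apply a) (at x)" and l: "l \<in> frechet_subdiff g x"
  shows "a + l \<in> frechet_subdiff (\<lambda>z. f z + g z) x"
  unfolding frechet_subdiff_iff
proof (intro allI impI)
  fix e :: real assume e: "e > 0"
  obtain d1 where d1: "d1 > 0"
    "\<And>v. norm v < d1 \<Longrightarrow> \<bar>f (x + v) - f x - blinfun_apply a v\<bar> \<le> e / 2 * norm v"
  proof -
    obtain d where "d > 0" and d: "\<And>y. norm (y - x) < d \<Longrightarrow>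
        norm (f y - f x - blinfun_apply a (y - x)) \<le> e / 2 * norm (y - x)"
      using f e unfolding has_derivative_at_alt by (metis half_gt_zero)
    show ?thesis
      by (rule that[OF \<open>d > 0\<close>]) (use d[of "x + v" for v] in simp)
  qed
  obtain d2 where d2: "d2 > 0"
    "\<And>v. norm v < d2 \<Longrightarrow> - (e / 2) * norm v \<le> g (x + v) - g x - blinfun_apply l v"
    using l e unfolding frechet_subdiff_iff by (meson half_gt_zero)
  have "- e * norm v \<le> f (x + v) + g (x + v) - (f x + g x) - blinfun_apply (a + l) v"
    if "norm v < min d1 d2" for v
    using d1(2)[of v] d2(2)[of v] that unfolding plus_blinfun.rep_eq
    by (smt (verit) field_sum_of_halves min_less_iff_conj minus_mult_left distrib_right)
  then show "\<exists>d>0. \<forall>v. norm v < d \<longrightarrow>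
      - e * norm v \<le> f (x + v) + g (x + v) - (f x + g x) - blinfun_apply (a + l) v"
    using d1(1) d2(1) by (intro exI[of _ "min d1 d2"]) auto
qed

section \<open>Functions that are convex up to a quadratic term of either sign\<close>

definition semiconvex :: "real \<Rightarrow> ('a::real_normed_vector \<Rightarrow> real) \<Rightarrow> bool" where
  "semiconvex \<kappa> g \<longleftrightarrow> (\<forall>u v. \<forall>s\<in>{0..1}.
     g (s *\<^sub>R u + (1 - s) *\<^sub>R v) \<le> s * g u + (1 - s) * g v - \<kappa> / 2 * s * (1 - s) * (norm (u - v))\<^sup>2)"

text \<open>Convexity along the segment from \<open>x\<close> to \<open>x + d\<close> turns the
  local inequality near \<open>x\<close> into a global one: compare both at
  \<open>x + s *\<^sub>R d\<close>, divide by \<open>s\<close> and let \<open>s\<close> tend to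
  \<open>0\<close>.\<close>

lemma semiconvex_subgradient:
  assumes g: "semiconvex \<kappa> g" and l: "l \<in> frechet_subdiff g x"
  shows "g x + blinfun_apply l d + \<kappa> / 2 * (norm d)\<^sup>2 \<le> g (x + d)"
proof (cases "d = 0")
  case False
  define D where "D = g (x + d) - g x - blinfun_apply l d - \<kappa> / 2 * (norm d)\<^sup>2"
  have bound: "- (e * norm d) \<le> D" if e: "e > 0" for e
  proof -
    obtain r where r: "r > 0"
      "\<And>v. norm v < r \<Longrightarrow> - e * norm v \<le> g (x + v) - g x - blinfun_apply l v"
      using l e unfolding frechet_subdiff_iff by meson
    \<comment> \<open>Below \<open>s0\<close> the point \<open>x + s *\<^sub>R d\<close> lies both
      on the segment and within the radius where the subgradient inequality is available.\<close>
    define s0 where "s0 = min 1 (r / norm d)"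
    have s0: "s0 > 0" using r(1) False by (simp add: s0_def)
    have "- (e * norm d) - s * (\<kappa> / 2 * (norm d)\<^sup>2) \<le> D" if s: "0 < s" "s < s0" for s
    proof -
      have "s < r / norm d" "s < 1" using s by (auto simp: s0_def)
      then have "norm (s *\<^sub>R d) < r" using False s by (simp add: pos_less_divide_eq)
      from r(2)[OF this]
      have lower: "- e * (s * norm d) \<le> g (x + s *\<^sub>R d) - g x - s * blinfun_apply l d"
        using s by (simp add: blinfun.scaleR_right)
      have "s *\<^sub>R (x + d) + (1 - s) *\<^sub>R x = x + s *\<^sub>R d" by (simp add: algebra_simps)
      then have "g (x + s *\<^sub>R d) \<le> s * g (x + d) + (1 - s) * g x - \<kappa> / 2 * s * (1 - s) * (norm d)\<^sup>2"
        using g[unfolded semiconvex_def, rule_format, of s "x + d" x] s \<open>s < 1\<close> by simp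
      \<comment> \<open>The factor \<open>1 - s\<close> in the curvature term leaves an error
        quadratic in \<open>s\<close>, which after division by \<open>s\<close> still vanishes with
        \<open>s\<close>.\<close>
      with lower have "s * (- (e * norm d) - s * (\<kappa> / 2 * (norm d)\<^sup>2)) \<le> s * D"
        by (simp add: D_def field_simps)
      then show ?thesis using s by simp
    qed
    then have ev: "eventually (\<lambda>s. - (e * norm d) - s * (\<kappa> / 2 * (norm d)\<^sup>2) \<le> D) (at_right 0)"
      using eventually_at_right_less[of "0::real"] s0 
      unfolding eventually_at_right_field by blast
    have "((\<lambda>s. - (e * norm d) - s * (\<kappa> / 2 * (norm d)\<^sup>2)) \<longlongrightarrow>
        - (e * norm d) - 0 * (\<kappa> / 2 * (norm d)\<^sup>2)) (at_right 0)"
      by (intro tendsto_intros)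
    from tendsto_upperbound[OF this ev] show ?thesis by simp
  qed
  have "0 \<le> D + e" if "e > 0" for e
    using bound[of "e / norm d"] that False by simp
  then have "0 \<le> D" by (rule field_le_epsilon)
  then show ?thesis by (simp add: D_def)
qed simp

text \<open>Local subgradient inequalities could hold on shrinking neighbourhoods only. The global
  version passes to the limit for each fixed \<open>p + v\<close>, and lower semicontinuity handles
  the values \<open>g (X n)\<close>.\<close>

lemma frechet_subdiff_closed:
  assumes g: "lower_semicont g" "semiconvex \<kappa> g"
    and l: "\<And>n. l n \<in> frechet_subdiff g (X n)" and X: "X \<longlonglongrightarrow> p" and L: "l \<longlonglongrightarrow> L"
  shows "L \<in> frechet_subdiff g p"
proof (rule frechet_subdiffI_quadratic)
  fix v
  let ?z = "p + v"
  let ?b = "\<lambda>n. g ?z - blinfun_apply (l n) (?z - X n) - \<kappa> / 2 * (norm (?z - X n))\<^sup>2"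
  have "?b \<longlonglongrightarrow> g ?z - blinfun_apply L (?z - p) - \<kappa> / 2 * (norm (?z - p))\<^sup>2"
    by (intro tendsto_intros X L blinfun.tendsto)
  moreover have "g (X n) \<le> ?b n" for n
    using semiconvex_subgradient[OF g(2) l[of n], of "?z - X n"] by simp
  ultimately have "g p \<le> g ?z - blinfun_apply L (?z - p) - \<kappa> / 2 * (norm (?z - p))\<^sup>2"
    by (rule lower_semicont_seq_le[OF g(1) X])
  then show "- (- \<kappa> / 2) * (norm v)\<^sup>2 \<le> g (p + v) - g p - blinfun_apply L v"
    by simp
qed

section \<open>Existence of minimizers of strongly convex functions\<close>

lemma strongly_convex_minimizer_exists:
  fixes h :: "'a::{real_normed_vector,complete_space} \<Rightarrow> real"
  assumes c: "c > 0"
    and mid: "\<And>u v. h ((1/2) *\<^sub>R (u + v)) \<le> h u / 2 + h v / 2 - c * (norm (u - v))\<^sup>2"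
    and bdd: "bdd_below (range h)"
    and lsc: "\<And>X p L. X \<longlonglongrightarrow> p \<Longrightarrow> (\<lambda>n. h (X n)) \<longlonglongrightarrow> L \<Longrightarrow> h p \<le> L"
  shows "\<exists>z. \<forall>w. h z \<le> h w"
proof -
  define m where "m = Inf (range h)"
  have m: "m \<le> h w" for w
    unfolding m_def by (rule cInf_lower[OF _ bdd]) simp
  have "\<exists>w. h w < m + 1 / real (Suc n)" for n
    using cInf_lessD[of "range h" "m + 1 / real (Suc n)"] by (auto simp: m_def)
  then obtain X where X: "\<And>n. h (X n) < m + 1 / real (Suc n)" by metis
  have hX: "(\<lambda>n. h (X n)) \<longlonglongrightarrow> m"
  proof (rule tendsto_sandwich[where f = "\<lambda>_. m"])
    show "eventually (\<lambda>n. h (X n) \<le> m + 1 / real (Suc n)) sequentially"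
      using X by (intro always_eventually allI less_imp_le)
    have "(\<lambda>n. m + 1 / real (Suc n)) \<longlonglongrightarrow> m + 0"
      by (intro tendsto_intros LIMSEQ_Suc[OF lim_1_over_n])
    then show "(\<lambda>n. m + 1 / real (Suc n)) \<longlonglongrightarrow> m" by simp
  qed (use m in auto)
  \<comment> \<open>Two nearly optimal points are close: their midpoint has value at least
    \<open>m\<close>, yet lies below the average by \<open>c\<close> times the squared distance.
    Values below \<open>m + c * e\<^sup>2\<close> thus force distance below
    \<open>e\<close>.\<close>
  have "Cauchy X"
  proof (rule metric_CauchyI)
    fix e :: real assume e: "e > 0"
    then have "m < m + c * e\<^sup>2" using c by simp
    then obtain N where N: "\<And>n. n \<ge> N \<Longrightarrow> h (X n) < m + c * e\<^sup>2"
      using order_tendstoD(2)[OF hX, of "m + c * e\<^sup>2"] unfolding eventually_sequentially by blast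
    have "dist (X i) (X j) < e" if "i \<ge> N" "j \<ge> N" for i j
    proof -
      have "c * (norm (X i - X j))\<^sup>2 < c * e\<^sup>2"
        using mid[of "X i" "X j"] m[of "(1/2) *\<^sub>R (X i + X j)"] N[OF that(1)] N[OF that(2)]
        by linarith
      then show ?thesis
        using c e by (simp add: dist_norm power_less_imp_less_base)
    qed
    then show "\<exists>M. \<forall>i\<ge>M. \<forall>j\<ge>M. dist (X i) (X j) < e" by blast
  qed
  then obtain z where "X \<longlonglongrightarrow> z"
    using Cauchy_convergent_iff convergent_def by blast
  from lsc[OF this hX] show ?thesis using m by (meson order_trans)
qed

section \<open>Bounds for the models and their minimizers\<close>

lemma linear_quadratic_lower_bound:
  fixes l :: "'a::real_normed_vector \<Rightarrow>\<^sub>L real"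
  assumes "c > 0"
  shows "- ((norm l)\<^sup>2 / (2 * c)) \<le> blinfun_apply l d + c / 2 * (norm d)\<^sup>2"
proof -
  have "\<bar>blinfun_apply l d\<bar> \<le> norm l * norm d"
    using norm_blinfun[of l d] by simp
  \<comment> \<open>Young's inequality, by expanding a square.\<close>
  moreover have "0 \<le> (norm l - c * norm d)\<^sup>2 / (2 * c)" using assms by simp
  then have "0 \<le> (norm l)\<^sup>2 / (2 * c) - norm l * norm d + c / 2 * (norm d)\<^sup>2"
    using assms by (simp add: field_simps power2_eq_square)
  ultimately show ?thesis by linarith
qed

text \<open>The curvatures of \<open>H x\<close>, \<open>g\<close> and the regularization add up,
  with slope \<open>f' x + \<mu>\<close> at \<open>0\<close>. This serves both to bound the model
  below and to estimate the step length.\<close>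

lemma model_lower_bound:
  assumes g: "semiconvex \<kappa>2 g" and \<mu>: "\<mu> \<in> frechet_subdiff g x"
    and H: "\<And>v. blinfun_apply (blinfun_apply (H x) v) v \<ge> \<kappa>1 * (norm v)\<^sup>2"
  shows "blinfun_apply (f' x + \<mu>) d + (\<kappa>1 + \<kappa>2 + \<omega>) / 2 * (norm d)\<^sup>2 \<le> model f' g H x \<omega> d"
  using semiconvex_subgradient[OF g \<mu>, of d] H[of d]
  by (simp add: model_def plus_blinfun.rep_eq algebra_simps add_divide_distrib)

text \<open>Parallelogram law in midpoint form.\<close>

lemma norm_midpoint_sq:
  fixes u v :: "'a::real_inner"
  shows "(norm ((1/2) *\<^sub>R (u + v)))\<^sup>2 = (norm u)\<^sup>2 / 2 + (norm v)\<^sup>2 / 2 - (norm (u - v))\<^sup>2 / 4"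
  by (simp add: power2_norm_eq_inner inner_add inner_diff inner_commute field_simps)

text \<open>The choice made by \<open>arg_min\<close> is a minimizer once one exists. Existence
  follows from strong convexity with modulus \<open>\<kappa>1 + \<kappa>2 + \<omega>\<close>; the
  subgradient \<open>\<mu>\<close> supplies the lower bound.\<close>

lemma exact_step_minimizes:
  fixes x :: "'a::{real_inner,complete_space}"
  assumes lsc: "lower_semicont g" and g: "semiconvex \<kappa>2 g" and \<mu>: "\<mu> \<in> frechet_subdiff g x"
    and H: "\<And>v. blinfun_apply (blinfun_apply (H x) v) v \<ge> \<kappa>1 * (norm v)\<^sup>2"
    and \<omega>: "\<omega> > - (\<kappa>1 + \<kappa>2)"
  shows "model f' g H x \<omega> (exact_step f' g H x \<omega>) \<le> model f' g H x \<omega> d"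
proof -
  let ?h = "model f' g H x \<omega>"
  define c where "c = \<kappa>1 + \<kappa>2 + \<omega>"
  have c: "c > 0" using \<omega> by (simp add: c_def)
  have "\<exists>z. \<forall>w. ?h z \<le> ?h w"
  proof (rule strongly_convex_minimizer_exists)
    \<comment> \<open>For convexity modulus \<open>c\<close> the gain
      \<open>c / 2 * s * (1 - s)\<close> equals \<open>c / 8\<close> at
      \<open>s = 1/2\<close>.\<close>
    show "c / 8 > 0" using c by simp
  next
    fix u v
    have "x + (1/2) *\<^sub>R (u + v) = (1/2) *\<^sub>R (x + u) + (1 - 1/2) *\<^sub>R (x + v)"
      by (simp add: algebra_simps flip: scaleR_add_left)
    then have G: "g (x + (1/2) *\<^sub>R (u + v)) \<le> g (x + u) / 2 + g (x + v) / 2 - \<kappa>2 / 8 * (norm (u - v))\<^sup>2"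
      using g[unfolded semiconvex_def, rule_format, of "1/2" "x + u" "x + v"] by simp
    \<comment> \<open>The parallelogram identity for the quadratic form leaves its value at
      \<open>u - v\<close>, where the lower bound on \<open>H x\<close> contributes
      \<open>\<kappa>1\<close>.\<close>
    have B: "blinfun_apply (blinfun_apply (H x) ((1/2) *\<^sub>R (u + v))) ((1/2) *\<^sub>R (u + v))
        = blinfun_apply (blinfun_apply (H x) u) u / 2 + blinfun_apply (blinfun_apply (H x) v) v / 2
          - blinfun_apply (blinfun_apply (H x) (u - v)) (u - v) / 4"
      by (simp add: blinfun.bilinear_simps field_simps)
    show "?h ((1/2) *\<^sub>R (u + v)) \<le> ?h u / 2 + ?h v / 2 - c / 8 * (norm (u - v))\<^sup>2"
      using G H[of "u - v"] unfolding model_def B norm_midpoint_sq c_def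
      by (simp add: blinfun.bilinear_simps field_simps)
  next
    have "- ((norm (f' x + \<mu>))\<^sup>2 / (2 * c)) \<le> ?h w" for w
      using linear_quadratic_lower_bound[OF c, of "f' x + \<mu>" w]
        model_lower_bound[where H = H and f' = f' and \<omega> = \<omega> and d = w, OF g \<mu> H]
      by (simp add: c_def)
    then show "bdd_below (range ?h)" by (intro bdd_belowI2)
  next
    fix X p L assume X: "X \<longlonglongrightarrow> p" and L: "(\<lambda>n. ?h (X n)) \<longlonglongrightarrow> L"
    \<comment> \<open>The continuous part \<open>q\<close> is split off, so that lower
      semicontinuity has to be applied to \<open>g\<close> alone.\<close>
    define q where "q w = blinfun_apply (f' x) w + 1/2 * blinfun_apply (blinfun_apply (H x) w) w
       + \<omega> / 2 * (norm w)\<^sup>2 - g x" for w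
    have hq: "?h w = q w + g (x + w)" for w by (simp add: q_def model_def)
    have "(\<lambda>n. q (X n)) \<longlonglongrightarrow> q p"
      unfolding q_def by (intro tendsto_intros X blinfun.tendsto)
    then have lim: "(\<lambda>n. ?h (X n) - q (X n)) \<longlonglongrightarrow> L - q p"
      by (intro tendsto_diff L)
    have "(\<lambda>n. x + X n) \<longlonglongrightarrow> x + p" by (intro tendsto_intros X)
    from lower_semicont_seq_le[OF lsc this lim] have "g (x + p) \<le> L - q p"
      by (simp add: hq)
    then show "?h p \<le> L" by (simp add: hq)
  qed
  then obtain z where "\<And>w. ?h z \<le> ?h w" by blast
  then have "is_arg_min ?h (\<lambda>_. True) z" by (simp add: is_arg_min_linorder)
  then have "is_arg_min ?h (\<lambda>_. True) (exact_step f' g H x \<omega>)"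
    unfolding exact_step_def arg_min_def by (rule someI)
  then show ?thesis by (simp add: is_arg_min_linorder)
qed

text \<open>This is an exact step for zero \<open>g\<close> and \<open>H\<close> and slope
  \<open>f' + \<mu>\<close>; the curvature is then \<open>\<omega>\<close> alone.\<close>

lemma subgrad_step_minimizes:
  fixes x :: "'a::{real_inner,complete_space}"
  assumes "\<omega> > 0"
  shows "subgrad_model f' \<mu> x \<omega> (subgrad_step f' \<mu> x \<omega>) \<le> subgrad_model f' \<mu> x \<omega> d"
proof -
  let ?f = "\<lambda>z. f' z + \<mu>" and ?g = "\<lambda>_::'a. 0::real"
    and ?H = "\<lambda>_. 0 :: 'a \<Rightarrow>\<^sub>L ('a \<Rightarrow>\<^sub>L real)"
  have eq: "subgrad_model f' \<mu> x \<omega> = model ?f ?g ?H x \<omega>"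
    by (auto simp: subgrad_model_def model_def plus_blinfun.rep_eq)
  have "lower_semicont ?g"
    by (auto simp: lower_semicont_def le_Liminf_iff intro!: always_eventually)
  moreover have "semiconvex 0 ?g" by (simp add: semiconvex_def)
  moreover have "0 \<in> frechet_subdiff ?g x"
    by (rule frechet_subdiffI_quadratic[of 0]) simp
  ultimately show ?thesis
    unfolding subgrad_step_def eq exact_step_def[symmetric]
    by (rule exact_step_minimizes[where ?\<kappa>1.0 = 0]) (use assms in auto)
qed

text \<open>Converse to \<open>linear_quadratic_lower_bound\<close>: a functional of larger norm
  would push the expression below \<open>b\<close> along some line. It bounds \<open>norm l\<close>
  without a formula for the minimizer.\<close>

lemma norm_le_of_quadratic_bound:
  fixes l :: "'a::real_normed_vector \<Rightarrow>\<^sub>L real"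
  assumes w: "w > 0" and b: "\<And>d. b \<le> blinfun_apply l d + w / 2 * (norm d)\<^sup>2"
  shows "(norm l)\<^sup>2 \<le> 2 * w * (- b)"
proof -
  have b0: "b \<le> 0" using b[of 0] by simp
  have "norm l \<le> sqrt (2 * w * (- b))"
  proof (rule norm_blinfun_bound)
    show "0 \<le> sqrt (2 * w * (- b))" using w b0 by (simp add: mult_nonneg_nonpos)
  next
    fix v
    show "norm (blinfun_apply l v) \<le> sqrt (2 * w * (- b)) * norm v"
    proof (cases "v = 0")
      case False
      define n where "n = norm v"
      define a where "a = blinfun_apply l v"
      have n: "n > 0" using False by (simp add: n_def)
      \<comment> \<open>\<open>t\<close> minimizes the quadratic
        \<open>t * a + w / 2 * (t\<^sup>2 * n\<^sup>2)\<close> on the line spanned by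
        \<open>v\<close>.\<close>
      define t where "t = - a / (w * n\<^sup>2)"
      have "b \<le> t * a + w / 2 * (t\<^sup>2 * n\<^sup>2)"
        using b[of "t *\<^sub>R v"] by (simp add: blinfun.scaleR_right a_def n_def power_mult_distrib)
      also have "\<dots> = - (a\<^sup>2 / (2 * w * n\<^sup>2))"
        using w n by (simp add: t_def field_simps power2_eq_square)
      finally have "a\<^sup>2 \<le> 2 * w * (- b) * n\<^sup>2"
        using w n by (simp add: field_simps)
      then have "sqrt (a\<^sup>2) \<le> sqrt (2 * w * (- b) * n\<^sup>2)" by (rule real_sqrt_le_mono)
      then show ?thesis using n by (simp only: real_sqrt_mult[of _ "n\<^sup>2"]) (simp add: a_def n_def)
    qed simp
  qed
  then have "(norm l)\<^sup>2 \<le> (sqrt (2 * w * (- b)))\<^sup>2" by (rule power_mono) simp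
  also have "\<dots> = 2 * w * (- b)" using w b0 by (simp add: mult_nonneg_nonpos)
  finally show ?thesis .
qed

text \<open>Moving from \<open>\<Delta>\<close> to \<open>\<Delta> + v\<close> changes the smooth
  part by its derivative plus a term quadratic in \<open>v\<close>, so minimality gives the premise
  of \<open>frechet_subdiffI_quadratic\<close>. Symmetry merges the two mixed terms of
  \<open>H x\<close>; \<open>blinfun_inner_right\<close> is the Riesz map.\<close>

lemma minimizer_subgradient:
  fixes x :: "'a::real_inner"
  assumes sym: "\<And>u v. blinfun_apply (blinfun_apply (H x) u) v = blinfun_apply (blinfun_apply (H x) v) u"
    and min: "\<And>d. model f' g H x \<omega> \<Delta> \<le> model f' g H x \<omega> d"
  shows "- (f' x + blinfun_apply (H x) \<Delta> + \<omega> *\<^sub>R blinfun_inner_right \<Delta>) \<in> frechet_subdiff g (x + \<Delta>)"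
proof (rule frechet_subdiffI_quadratic)
  fix v
  have "blinfun_apply (blinfun_apply (H x) v) v \<le> norm (H x) * norm v * norm v"
    using norm_blinfun[of "blinfun_apply (H x) v" v] norm_blinfun[of "H x" v]
    by (smt (verit) mult_right_mono norm_ge_zero real_norm_def)
  then have "blinfun_apply (blinfun_apply (H x) v) v \<le> norm (H x) * (norm v)\<^sup>2"
    by (simp add: power2_eq_square mult.assoc)
  moreover have "(norm (\<Delta> + v))\<^sup>2 = (norm \<Delta>)\<^sup>2 + 2 * (\<Delta> \<bullet> v) + (norm v)\<^sup>2"
    by (simp add: power2_norm_eq_inner inner_add inner_commute)
  ultimately show "- ((norm (H x) + \<omega>) / 2) * (norm v)\<^sup>2 \<le> g (x + \<Delta> + v) - g (x + \<Delta>)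
      - blinfun_apply (- (f' x + blinfun_apply (H x) \<Delta> + \<omega> *\<^sub>R blinfun_inner_right \<Delta>)) v"
    using min[of "\<Delta> + v"] sym[of \<Delta> v]
    by (simp add: model_def blinfun.bilinear_simps blinfun_inner_right.rep_eq field_simps)
qed


theorem theorem4p6:
  fixes f g F :: "'a::{real_inner,complete_space} \<Rightarrow> real"
    and f' :: "'a \<Rightarrow> ('a \<Rightarrow>\<^sub>L real)"
    and H :: "'a \<Rightarrow> ('a \<Rightarrow>\<^sub>L ('a \<Rightarrow>\<^sub>L real))"
    and Lf \<kappa>2 M \<omega>max \<gamma> :: real
    and x \<Delta>s y :: "nat \<Rightarrow> 'a"
    and \<omega> :: "nat \<Rightarrow> real"
    and \<mu> :: "nat \<Rightarrow> ('a \<Rightarrow>\<^sub>L real)"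
  assumes F_def: "\<And>z. F z = f z + g z"
    and f_deriv: "\<And>z. (f has_derivative blinfun_apply (f' z)) (at z)"
    and f'_cont: "continuous_on UNIV f'"
    and Lf_pos: "Lf > 0"
    and f'_lipschitz: "Lf-lipschitz_on UNIV f'"
    and g_lsc: "lower_semicont g"
    and g_convex: "\<And>u v s. s \<in> {0..1} \<Longrightarrow>
      g (s *\<^sub>R u + (1 - s) *\<^sub>R v) \<le> s * g u + (1 - s) * g v - \<kappa>2 / 2 * s * (1 - s) * (norm (u - v))\<^sup>2"
    and H_sym: "\<And>z u v. blinfun_apply (blinfun_apply (H z) u) v = blinfun_apply (blinfun_apply (H z) v) u"
    and M_pos: "M > 0"
    and H_bound: "\<And>k. norm (H (x k)) \<le> M"
    and H_lower_and_\<omega>: "\<And>k. \<exists>\<kappa>1::real.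
      (\<forall>v. blinfun_apply (blinfun_apply (H (x k)) v) v \<ge> \<kappa>1 * (norm v)\<^sup>2) \<and> \<omega> k > - (\<kappa>1 + \<kappa>2)"
    and F_bdd_below: "bdd_below (range (\<lambda>k. F (x k)))"
    and \<omega>_bounded: "bounded (range \<omega>)"
    and \<omega>max_pos: "\<omega>max > 0"
    and \<gamma>_range: "0 < \<gamma>" "\<gamma> < 1"
    and iterates: "\<And>k. x (Suc k) = x k + \<Delta>s k"
    and \<mu>_subgrad: "\<And>k. \<mu> k \<in> frechet_subdiff g (x k)"
    and inexactness: "\<And>k. subgradient_inexactness f' g H \<omega>max (x k) (\<mu> k) (\<omega> k) (\<Delta>s k)"
    and decrease: "\<And>k. sufficient_decrease F f' g H \<gamma> (x k) (\<omega> k) (\<Delta>s k)"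
    and y_def: "\<And>k. y k = x k + exact_step f' g H (x k) (\<omega>max + \<omega> k + 1)"
  shows "(\<forall>p. accumulation_point x p \<longrightarrow> 0 \<in> frechet_subdiff F p)
    \<and> (\<lambda>k. dist_to_zero (frechet_subdiff F (y k))) \<longlonglongrightarrow> 0
    \<and> (\<lambda>k. norm (x k - y k)) \<longlonglongrightarrow> 0
    \<and> (\<forall>p r. strict_mono r \<and> (x \<circ> r) \<longlonglongrightarrow> p \<longrightarrow> (y \<circ> r) \<longlonglongrightarrow> p)"
proof -
  have g: "semiconvex \<kappa>2 g" using g_convex by (auto simp: semiconvex_def)
  have F_eq: "F = (\<lambda>z. f z + g z)" using F_def by auto

  \<comment> \<open>Descent and vanishing of the subgradients \<open>l\<close>\<close>
  define l where "l k = f' (x k) + \<mu> k" for k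
  have descent: "(norm (l k))\<^sup>2 \<le> 2 * \<omega>max / \<gamma> * (F (x k) - F (x (Suc k)))" for k
  proof -
    obtain w where w: "0 < w" "w < \<omega>max" and le: "model f' g H (x k) (\<omega> k) (\<Delta>s k)
        \<le> subgrad_model f' (\<mu> k) (x k) w (subgrad_step f' (\<mu> k) (x k) w)"
      using inexactness[of k] by (auto simp: subgradient_inexactness_def)
    \<comment> \<open>\<open>w\<close> depends on \<open>k\<close>; enlarging it to
      \<open>\<omega>max\<close> makes the constant uniform, and minimality of the subgradient step
      lets any \<open>d\<close> take its place.\<close>
    have "model f' g H (x k) (\<omega> k) (\<Delta>s k) \<le> blinfun_apply (l k) d + \<omega>max / 2 * (norm d)\<^sup>2" for d
    proof -
      have "w / 2 * (norm d)\<^sup>2 \<le> \<omega>max / 2 * (norm d)\<^sup>2"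
        using w by (intro mult_right_mono) auto
      then show ?thesis
        using order_trans[OF le subgrad_step_minimizes[OF w(1), where d = d]]
        by (simp add: subgrad_model_def l_def plus_blinfun.rep_eq)
    qed
    from norm_le_of_quadratic_bound[OF \<omega>max_pos this]
    have "(norm (l k))\<^sup>2 \<le> 2 * \<omega>max * - model f' g H (x k) (\<omega> k) (\<Delta>s k)" .
    also have "\<dots> \<le> 2 * \<omega>max * ((F (x k) - F (x (Suc k))) / \<gamma>)"
    proof (rule mult_left_mono)
      show "- model f' g H (x k) (\<omega> k) (\<Delta>s k) \<le> (F (x k) - F (x (Suc k))) / \<gamma>"
        using decrease[of k] \<gamma>_range(1)
        by (simp add: sufficient_decrease_def iterates field_simps)
    qed (use \<omega>max_pos in simp)
    finally show ?thesis by simp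
  qed
  \<comment> \<open>The values decrease and are bounded below, hence converge; their successive
    differences vanish, and with them the squared norms of \<open>l\<close>.\<close>
  have "decseq (\<lambda>k. F (x k))"
  proof (rule decseq_SucI)
    fix k
    have "0 \<le> 2 * \<omega>max / \<gamma> * (F (x k) - F (x (Suc k)))"
      using descent[of k] by (meson order_trans zero_le_power2)
    then show "F (x (Suc k)) \<le> F (x k)"
      using \<omega>max_pos \<gamma>_range(1) by (simp add: zero_le_mult_iff zero_le_divide_iff)
  qed
  then obtain Fl where Fl: "(\<lambda>k. F (x k)) \<longlonglongrightarrow> Fl"
    using F_bdd_below decseq_convergent[of "\<lambda>k. F (x k)"] by (metis bdd_below.E rangeI)
  have "(\<lambda>k. (norm (l k))\<^sup>2) \<longlonglongrightarrow> 0"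
  proof (rule tendsto_sandwich[where f = "\<lambda>_. 0"])
    have "(\<lambda>k. 2 * \<omega>max / \<gamma> * (F (x k) - F (x (Suc k)))) \<longlonglongrightarrow> 2 * \<omega>max / \<gamma> * (Fl - Fl)"
      by (intro tendsto_intros Fl LIMSEQ_Suc[OF Fl])
    then show "(\<lambda>k. 2 * \<omega>max / \<gamma> * (F (x k) - F (x (Suc k)))) \<longlonglongrightarrow> 0" by simp
  qed (use descent in auto)
  then have norm_l: "(\<lambda>k. norm (l k)) \<longlonglongrightarrow> 0"
    using tendsto_real_sqrt[of "\<lambda>k. (norm (l k))\<^sup>2" 0] by simp
  then have l: "l \<longlonglongrightarrow> 0" by (rule tendsto_norm_zero_cancel)

  \<comment> \<open>Stationarity of accumulation points\<close>
  have stationary: "0 \<in> frechet_subdiff F p" if r: "strict_mono r" "(x \<circ> r) \<longlonglongrightarrow> p" for p r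
  proof -
    have "(\<lambda>k. f' ((x \<circ> r) k)) \<longlonglongrightarrow> f' p"
      using continuous_on_tendsto_compose[OF f'_cont r(2)] by simp
    \<comment> \<open>Continuity of \<open>f'\<close> turns \<open>l\<close> tending to
      \<open>0\<close> into convergence of the subgradients of \<open>g\<close>. The closed graph is
      used for \<open>g\<close>, and \<open>f' p\<close> is added back in the limit.\<close>
    then have "(\<lambda>k. (l \<circ> r) k - f' ((x \<circ> r) k)) \<longlonglongrightarrow> 0 - f' p"
      by (intro tendsto_diff LIMSEQ_subseq_LIMSEQ[OF l r(1)])
    then have "(\<mu> \<circ> r) \<longlonglongrightarrow> - f' p" by (simp add: l_def o_def)
    from frechet_subdiff_closed[OF g_lsc g _ r(2) this] have "- f' p \<in> frechet_subdiff g p"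
      by (simp add: \<mu>_subgrad)
    from frechet_subdiff_add_differentiable[OF f_deriv this] show ?thesis
      by (simp add: F_eq)
  qed

  \<comment> \<open>Length of the comparison steps\<close>
  define \<Delta> where "\<Delta> k = exact_step f' g H (x k) (\<omega>max + \<omega> k + 1)" for k
  have y: "y k = x k + \<Delta> k" for k by (simp add: y_def \<Delta>_def)
  have min: "model f' g H (x k) (\<omega>max + \<omega> k + 1) (\<Delta> k) \<le> model f' g H (x k) (\<omega>max + \<omega> k + 1) d"
    and \<Delta>_bound: "norm (\<Delta> k) \<le> 2 * norm (l k)" for k d
  proof -
    obtain \<kappa>1 where \<kappa>1: "\<And>v. blinfun_apply (blinfun_apply (H (x k)) v) v \<ge> \<kappa>1 * (norm v)\<^sup>2"
      "\<omega> k > - (\<kappa>1 + \<kappa>2)"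
      using H_lower_and_\<omega> by blast
    show *: "model f' g H (x k) (\<omega>max + \<omega> k + 1) (\<Delta> k) \<le> model f' g H (x k) (\<omega>max + \<omega> k + 1) d" for d
      unfolding \<Delta>_def by (rule exact_step_minimizes[where H = H, OF g_lsc g \<mu>_subgrad \<kappa>1(1)])
        (use \<kappa>1(2) \<omega>max_pos in simp)
    \<comment> \<open>Since \<open>\<omega> k > - (\<kappa>1 + \<kappa>2)\<close> and
      \<open>\<omega>max > 0\<close>, the added \<open>1\<close> keeps the curvature above
      \<open>1\<close>, whatever \<open>\<kappa>1\<close> is for this \<open>k\<close>.\<close>
    have "1 / 2 * (norm (\<Delta> k))\<^sup>2 \<le> (\<kappa>1 + \<kappa>2 + (\<omega>max + \<omega> k + 1)) / 2 * (norm (\<Delta> k))\<^sup>2"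
      using \<kappa>1(2) \<omega>max_pos by (intro mult_right_mono) auto
    \<comment> \<open>The model vanishes at \<open>d = 0\<close>, so its minimum is at most
      \<open>0\<close>.\<close>
    also have "\<dots> \<le> - blinfun_apply (l k) (\<Delta> k)"
      using *[of 0] model_lower_bound[where H = H and f' = f' and \<omega> = "\<omega>max + \<omega> k + 1" and d = "\<Delta> k",
          OF g \<mu>_subgrad \<kappa>1(1)]
      by (simp add: model_def l_def)
    also have "\<dots> \<le> norm (l k) * norm (\<Delta> k)"
      using norm_blinfun[of "l k" "\<Delta> k"] by simp
    finally show "norm (\<Delta> k) \<le> 2 * norm (l k)"
      by (cases "\<Delta> k = 0") (auto simp: power2_eq_square)
  qed
  have norm_\<Delta>: "(\<lambda>k. norm (\<Delta> k)) \<longlonglongrightarrow> 0"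
  proof (rule tendsto_sandwich[where f = "\<lambda>_. 0"])
    show "(\<lambda>k. 2 * norm (l k)) \<longlonglongrightarrow> 0"
      using tendsto_mult_right_zero[OF norm_l] by simp
  qed (use \<Delta>_bound in auto)

  \<comment> \<open>Small subgradients at the comparison points\<close>
  obtain W where W: "\<And>k. \<bar>\<omega> k\<bar> \<le> W"
    using \<omega>_bounded by (auto simp: bounded_iff)
  \<comment> \<open>Per unit of step length, the summands bound the change of \<open>f'\<close>, the
    operator \<open>H (x k)\<close> and the regularization term.\<close>
  define C where "C = Lf + M + (\<omega>max + W + 1)"
  have dist: "dist_to_zero (frechet_subdiff F (y k)) \<le> ereal (C * norm (\<Delta> k))" for k
  proof -
    define c where "c = \<omega>max + \<omega> k + 1"
    define \<nu> where "\<nu> = - (f' (x k) + blinfun_apply (H (x k)) (\<Delta> k) + c *\<^sub>R blinfun_inner_right (\<Delta> k))"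
    have "\<nu> \<in> frechet_subdiff g (y k)"
      unfolding \<nu>_def y c_def by (intro minimizer_subgradient H_sym min)
    from frechet_subdiff_add_differentiable[OF f_deriv this]
    have "f' (y k) + \<nu> \<in> frechet_subdiff F (y k)" by (simp add: F_eq)
    \<comment> \<open>An explicit subgradient bounds the infimum and in particular keeps it
      finite.\<close>
    then have "dist_to_zero (frechet_subdiff F (y k)) \<le> ereal (norm (f' (y k) + \<nu>))"
      unfolding dist_to_zero_def by (rule INF_lower)
    also have "norm (f' (y k) + \<nu>) \<le> C * norm (\<Delta> k)"
    proof -
      \<comment> \<open>The term \<open>- f' (x k)\<close> inside \<open>\<nu>\<close> leaves only a
        difference of \<open>f'\<close>, so every remaining term is of the order of the
        step.\<close>
      have "f' (y k) + \<nu> = (f' (y k) - f' (x k)) - blinfun_apply (H (x k)) (\<Delta> k)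
          - c *\<^sub>R blinfun_inner_right (\<Delta> k)"
        by (simp add: \<nu>_def)
      then have "norm (f' (y k) + \<nu>) \<le> norm (f' (y k) - f' (x k))
          + norm (blinfun_apply (H (x k)) (\<Delta> k)) + norm (c *\<^sub>R blinfun_inner_right (\<Delta> k))"
        by (smt (verit) norm_triangle_ineq4)
      moreover have "norm (f' (y k) - f' (x k)) \<le> Lf * norm (\<Delta> k)"
        using lipschitz_onD[OF f'_lipschitz, of "y k" "x k"] by (simp add: dist_norm y)
      moreover have "norm (blinfun_apply (H (x k)) (\<Delta> k)) \<le> M * norm (\<Delta> k)"
        using norm_blinfun[of "H (x k)" "\<Delta> k"] mult_right_mono[OF H_bound[of k] norm_ge_zero[of "\<Delta> k"]]
        by linarith
      moreover have "norm (c *\<^sub>R blinfun_inner_right (\<Delta> k)) \<le> (\<omega>max + W + 1) * norm (\<Delta> k)"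
      proof -
        have "norm (blinfun_inner_right (\<Delta> k)) \<le> norm (\<Delta> k)"
          by (rule norm_blinfun_bound) (simp_all add: blinfun_inner_right.rep_eq Cauchy_Schwarz_ineq2)
        moreover have "\<bar>c\<bar> \<le> \<omega>max + W + 1" using W[of k] \<omega>max_pos by (simp add: c_def)
        ultimately show ?thesis by (simp add: mult_mono)
      qed
      ultimately show ?thesis by (simp add: C_def algebra_simps)
    qed
    finally show ?thesis by simp
  qed
  have "(\<lambda>k. dist_to_zero (frechet_subdiff F (y k))) \<longlonglongrightarrow> 0"
  proof (rule tendsto_sandwich[where f = "\<lambda>_. 0"])
    show "eventually (\<lambda>k. 0 \<le> dist_to_zero (frechet_subdiff F (y k))) sequentially"
      unfolding dist_to_zero_def by (intro always_eventually allI INF_greatest) simp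
    show "eventually (\<lambda>k. dist_to_zero (frechet_subdiff F (y k)) \<le> ereal (C * norm (\<Delta> k))) sequentially"
      using dist by simp
    show "(\<lambda>k. ereal (C * norm (\<Delta> k))) \<longlonglongrightarrow> 0"
      using tendsto_mult_right_zero[OF norm_\<Delta>, of C] by (simp add: zero_ereal_def)
  qed simp
  moreover have "(y \<circ> r) \<longlonglongrightarrow> p" if r: "strict_mono r" "(x \<circ> r) \<longlonglongrightarrow> p" for p r
  proof -
    have "(\<lambda>k. (x \<circ> r) k + (\<Delta> \<circ> r) k) \<longlonglongrightarrow> p + 0"
      by (intro tendsto_add r(2) LIMSEQ_subseq_LIMSEQ[OF tendsto_norm_zero_cancel[OF norm_\<Delta>] r(1)])
    then show ?thesis by (simp add: o_def y)
  qed
  moreover have "(\<lambda>k. norm (x k - y k)) \<longlonglongrightarrow> 0"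
    using norm_\<Delta> by (simp add: y)
  ultimately show ?thesis
    using stationary unfolding accumulation_point_def by blast
qed

end
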